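(* Let $(X,T)$ be a minimal mean equicontinuous topological dynamical system, and let $\mu$ be its unique invariant Borel probability measure. There is a Borel set $X_0\subset X$ with $\mu(X_0)=1$ such that for any $d\in\mathbb{N}$ and any $x\in X_0$, the point $(x,x,\ldots,x)\in X^d$ is a minimal point for $T\times T^2\times\cdots\times T^d$.
   Context: A topological dynamical system (t.d.s.) $(X,T)$ is a compact metric space $X$ (metric $\rho$) with a continuous map $T:X\to X$. It is minimal if every forward orbit is dense in $X$. It is mean equicontinuous if for every $\varepsilon>0$ there is $\delta>0$ such that $\rho(x,y)\le\delta$ implies $\limsup_{n\to\infty}\frac1n\sum_{i=1}^n \rho(T^ix,T^iy)\le\varepsilon$. A minimal mean equicontinuous t.d.s. is uniquely ergodic (known fact). For a t.d.s. $(Y,S)$, a point $y\in Y$ is a minimal point for $S$ if the forward orbit closure $\overline{\{S^ny:n\in\mathbb{Z}_+\}}$ with the restriction of $S$ is a minimal t.d.s. The map $T\times T^2\times\cdots\times T^d$ acts on $X^d$ by $(x_1,\ldots,x_d)\mapsto(Tx_1,T^2x_2,\ldots,T^dx_d)$. *)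

theory Defs
  imports "HOL-Probability.Probability"
begin

text \<open>A system lives on a carrier set \<open>X\<close> of a metric space type, so that orbit closures and
  products are again systems in the same sense; the values of \<open>T\<close> outside \<open>X\<close> play no role.\<close>

definition tds :: "'a::metric_space set \<Rightarrow> ('a \<Rightarrow> 'a) \<Rightarrow> bool" where
  "tds X T \<longleftrightarrow> compact X \<and> continuous_on X T \<and> T ` X \<subseteq> X"

definition forward_orbit :: "('a \<Rightarrow> 'a) \<Rightarrow> 'a \<Rightarrow> 'a set" where
  "forward_orbit T x = range (\<lambda>n::nat. (T ^^ n) x)"

definition minimal_tds :: "'a::metric_space set \<Rightarrow> ('a \<Rightarrow> 'a) \<Rightarrow> bool" where
  "minimal_tds X T \<longleftrightarrow> tds X T \<and> (\<forall>x\<in>X. X \<subseteq> closure (forward_orbit T x))"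

definition mean_equicontinuous :: "'a::metric_space set \<Rightarrow> ('a \<Rightarrow> 'a) \<Rightarrow> bool" where
  "mean_equicontinuous X T \<longleftrightarrow>
     (\<forall>\<epsilon>>0. \<exists>\<delta>>0. \<forall>x\<in>X. \<forall>y\<in>X. dist x y \<le> \<delta> \<longrightarrow>
        limsup (\<lambda>n. ereal ((1 / real n) * (\<Sum>i=1..n. dist ((T ^^ i) x) ((T ^^ i) y)))) \<le> ereal \<epsilon>)"

definition minimal_point :: "'a::metric_space set \<Rightarrow> ('a \<Rightarrow> 'a) \<Rightarrow> 'a \<Rightarrow> bool" where
  "minimal_point Y S y \<longleftrightarrow> y \<in> Y \<and> minimal_tds (Y \<inter> closure (forward_orbit S y)) S"

definition invariant_borel_prob :: "'a::metric_space set \<Rightarrow> ('a \<Rightarrow> 'a) \<Rightarrow> 'a measure \<Rightarrow> bool" where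
  "invariant_borel_prob X T \<mu> \<longleftrightarrow>
     prob_space \<mu> \<and> sets \<mu> = sets (restrict_space borel X) \<and> distr \<mu> \<mu> T = \<mu>"

text \<open>The power \<open>X\<^sup>d\<close> consists of the extensional functions \<open>{1..d} \<rightarrow> X\<close>, inside the type
  \<open>nat \<Rightarrow> 'a\<close> with the library metric on countable products. All coordinates outside \<open>{1..d}\<close>
  equal \<open>undefined\<close>, so this metric induces exactly the product topology on \<open>X\<^sup>d\<close>.\<close>

definition power_space :: "nat \<Rightarrow> 'a set \<Rightarrow> (nat \<Rightarrow> 'a) set" where
  "power_space d X = (\<Pi>\<^sub>E j\<in>{1..d}. X)"

definition diagonal_point :: "nat \<Rightarrow> 'a \<Rightarrow> (nat \<Rightarrow> 'a)" where
  "diagonal_point d x = (\<lambda>j\<in>{1..d}. x)"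

definition product_powers_map :: "nat \<Rightarrow> ('a \<Rightarrow> 'a) \<Rightarrow> (nat \<Rightarrow> 'a) \<Rightarrow> (nat \<Rightarrow> 'a)" where
  "product_powers_map d T f = (\<lambda>j\<in>{1..d}. (T ^^ j) (f j))"

end

theory Submission
  imports Defs
begin

text \<open>Mean equicontinuity makes \<open>d(x, y) = limsup (1/N) \<Sum>i<N. \<rho>(T\<^sup>i x, T\<^sup>i y)\<close> a continuous, hence totally
  bounded, pseudometric, for which \<open>T\<close> is an isometry. By the pigeonhole principle and minimality,
  \<open>d(T\<^sup>n x, x)\<close> is uniformly small for a set of \<open>n\<close> of positive density, and integrating against the
  invariant measure bounds \<open>\<integral> \<rho>(T\<^sup>n x, x) d\<mu>\<close> for these \<open>n\<close>. Hence \<open>\<mu>(B - T\<^bsup>-jn\<^esup> B)\<close> is small for every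
  Borel set \<open>B\<close> and all \<open>j \<le> d\<close>, so a set of positive measure recurs multiply with positive density on
  average. Applied to the exceptional set itself, this shows that almost every \<open>x\<close> satisfies
  \<open>T\<^bsup>jn\<^esup> x \<approx> x\<close> for all \<open>j \<le> d\<close> simultaneously, along a set of \<open>n\<close> of positive upper density. For such \<open>x\<close>,
  every point in the orbit closure of the diagonal point shadows that orbit outside a set of times of
  small density, so its own orbit returns to the diagonal point.\<close>

subsection \<open>Return times of mean equicontinuous systems\<close>

lemma funpow_in:
  assumes "f ` S \<subseteq> S" "x \<in> S"
  shows "(f ^^ n) x \<in> S"
  using assms by (induction n) auto

lemma continuous_on_funpow:
  fixes f :: "'a::topological_space \<Rightarrow> 'a"
  assumes "continuous_on S f" "f ` S \<subseteq> S"
  shows "continuous_on S (f ^^ n)"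
proof (induction n)
  case (Suc n)
  have "(f ^^ n) ` S \<subseteq> S"
    using funpow_in[OF assms(2)] by blast
  then have "continuous_on S (f \<circ> f ^^ n)"
    using Suc assms(1) by (intro continuous_on_compose) (auto intro: continuous_on_subset)
  then show ?case by simp
qed (simp add: id_def)

lemma funpow_funpow: "(f ^^ m) ((f ^^ n) x) = (f ^^ (m + n)) x"
  by (simp add: funpow_add)

locale minimal_mean_equicontinuous =
  fixes X :: "'a::metric_space set" and T :: "'a \<Rightarrow> 'a"
  assumes minimal: "minimal_tds X T"
    and mean_equi: "mean_equicontinuous X T"
begin

lemma compact_X: "compact X" and continuous_T: "continuous_on X T" and T_image: "T ` X \<subseteq> X"
  using minimal by (auto simp: minimal_tds_def tds_def)

lemma iter_in: "x \<in> X \<Longrightarrow> (T ^^ n) x \<in> X"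
  by (rule funpow_in[OF T_image])

lemma continuous_iter: "continuous_on X (T ^^ n)"
  by (rule continuous_on_funpow[OF continuous_T T_image])

lemma dist_bound: "\<exists>D\<ge>0. \<forall>x\<in>X. \<forall>y\<in>X. dist x y \<le> D"
proof -
  obtain D where "\<forall>x\<in>X. \<forall>y\<in>X. dist x y \<le> D"
    using compact_imp_bounded[OF compact_X] unfolding bounded_two_points by blast
  then show ?thesis
    by (intro exI[of _ "max 0 D"]) (auto intro: max.coboundedI2)
qed

text \<open>Mean equicontinuity freed from the limsup and from averages over \<open>1..n\<close>.
  Starting the sum at \<open>i = 0\<close> adds only the term \<open>dist x y\<close>, which is
  absorbed once \<open>N\<close> is large.\<close>

lemma eventually_sum_dist_le:
  assumes "0 < \<eta>"
  shows "\<exists>\<delta>>0. \<forall>x\<in>X. \<forall>y\<in>X. dist x y \<le> \<delta> \<longrightarrow>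
    (\<forall>\<^sub>F N in sequentially. (\<Sum>i<N. dist ((T ^^ i) x) ((T ^^ i) y)) \<le> \<eta> * real N)"
proof -
  \<comment> \<open>The gap between \<eta>/3 and \<eta>/2 turns the bound on the limsup into an
    eventual bound on the averages. The remaining \<eta>/2 pays for the term
    \<open>i = 0\<close>.\<close>
  have "\<eta>/3 > 0" using assms by simp
  then obtain \<delta> where "\<delta> > 0" and \<delta>: "\<And>x y. x \<in> X \<Longrightarrow> y \<in> X \<Longrightarrow> dist x y \<le> \<delta> \<Longrightarrow>
     limsup (\<lambda>n. ereal ((1 / real n) * (\<Sum>i=1..n. dist ((T ^^ i) x) ((T ^^ i) y)))) \<le> ereal (\<eta>/3)"
    using mean_equi[unfolded mean_equicontinuous_def, rule_format, of "\<eta>/3"] by blast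
  have "\<forall>\<^sub>F N in sequentially. (\<Sum>i<N. dist ((T ^^ i) x) ((T ^^ i) y)) \<le> \<eta> * real N"
    if "x \<in> X" "y \<in> X" "dist x y \<le> \<delta>" for x y
  proof -
    have "limsup (\<lambda>n. ereal ((1 / real n) * (\<Sum>i=1..n. dist ((T ^^ i) x) ((T ^^ i) y)))) < ereal (\<eta>/2)"
      using \<delta>[OF that] assms by (rule_tac le_less_trans) auto
    then have ev: "\<forall>\<^sub>F n in sequentially.
        ereal ((1 / real n) * (\<Sum>i=1..n. dist ((T ^^ i) x) ((T ^^ i) y))) < ereal (\<eta>/2)"
      by (rule Limsup_lessD)
    obtain M :: nat where M: "2 * dist x y / \<eta> \<le> real M"
      using real_arch_simple by blast
    show ?thesis
      using ev eventually_ge_at_top[of "max 1 M"]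
    proof eventually_elim
      case (elim N)
      then have N: "N \<ge> 1" "real M \<le> real N" by auto
      have "(\<Sum>i<N. dist ((T ^^ i) x) ((T ^^ i) y)) \<le> (\<Sum>i=0..N. dist ((T ^^ i) x) ((T ^^ i) y))"
        by (rule sum_mono2) auto
      also have "\<dots> = dist x y + (\<Sum>i=1..N. dist ((T ^^ i) x) ((T ^^ i) y))"
        by (simp add: sum.atLeast_Suc_atMost)
      also have "(\<Sum>i=1..N. dist ((T ^^ i) x) ((T ^^ i) y)) \<le> \<eta>/2 * N"
        using elim(1) N by (simp add: field_simps)
      also have "dist x y \<le> \<eta>/2 * N"
        using order_trans[OF M N(2)] assms by (simp add: field_simps)
      finally show ?case by (simp add: field_simps)
    qed
  qed
  then show ?thesis
    using \<open>\<delta> > 0\<close> by blast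
qed

text \<open>A bound on the Besicovitch distance from \<open>T ^^ n\<close> to the identity at every
  point, written with partial sums. The threshold for \<open>M\<close> may depend on
  \<open>x\<close>; dominated convergence later tolerates this.\<close>

definition mean_returns :: "real \<Rightarrow> nat set" where
  "mean_returns \<eta> = {n. \<forall>x\<in>X. \<forall>\<^sub>F M in sequentially.
     (\<Sum>i<M. dist ((T ^^ i) ((T ^^ n) x)) ((T ^^ i) x)) \<le> \<eta> * real M}"

text \<open>One close return \<open>T\<^sup>n y \<approx> y\<close> controls the orbits of all points, since the Besicovitch distance
  \<open>limsup (1/M) \<Sum>i<M. dist (T\<^sup>i x) (T\<^sup>i y)\<close> is continuous and \<open>T\<close>-invariant and the orbit of \<open>y\<close> is dense.\<close>

lemma mean_returns_from_point:
  assumes "0 < \<eta>"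
  shows "\<exists>\<delta>>0. \<forall>y\<in>X. \<forall>n. dist ((T ^^ n) y) y \<le> \<delta> \<longrightarrow> n \<in> mean_returns \<eta>"
proof -
  obtain \<delta> where "\<delta> > 0" and \<delta>: "\<And>x y. x \<in> X \<Longrightarrow> y \<in> X \<Longrightarrow> dist x y \<le> \<delta> \<Longrightarrow>
      \<forall>\<^sub>F N in sequentially. (\<Sum>i<N. dist ((T ^^ i) x) ((T ^^ i) y)) \<le> \<eta>/4 * real N"
    using eventually_sum_dist_le[of "\<eta>/4"] assms by auto
  have "n \<in> mean_returns \<eta>" if y: "y \<in> X" and n: "dist ((T ^^ n) y) y \<le> \<delta>" for y n
    unfolding mean_returns_def
  proof (intro CollectI ballI)
    fix x assume x: "x \<in> X"
    \<comment> \<open>Continuity of \<open>T ^^ n\<close> at \<open>x\<close> is needed so that one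
      orbit point \<open>u\<close> of \<open>y\<close> near \<open>x\<close> serves twice:
      \<open>u\<close> is close to \<open>x\<close> and \<open>T ^^ n\<close> of \<open>u\<close> is
      close to \<open>T ^^ n\<close> of \<open>x\<close>.\<close>
    have "continuous_on X (T ^^ n)" by (rule continuous_iter)
    then obtain \<gamma> where "\<gamma> > 0" and \<gamma>: "\<And>u. u \<in> X \<Longrightarrow> dist u x < \<gamma> \<Longrightarrow> dist ((T ^^ n) u) ((T ^^ n) x) < \<delta>"
      using x \<open>\<delta> > 0\<close> unfolding continuous_on_iff by metis
    have "x \<in> closure (forward_orbit T y)"
      using minimal y x by (auto simp: minimal_tds_def)
    then obtain l where l: "dist ((T ^^ l) y) x < min \<gamma> \<delta>"
      using \<open>\<gamma> > 0\<close> \<open>\<delta> > 0\<close> unfolding closure_approachable forward_orbit_def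
      by (metis (no_types, lifting) min_less_iff_conj rangeE)
    define u where "u = (T ^^ l) y"
    have u: "u \<in> X" unfolding u_def by (rule iter_in[OF y])
    have 1: "\<forall>\<^sub>F M in sequentially.
        (\<Sum>i<M. dist ((T ^^ i) ((T ^^ n) u)) ((T ^^ i) ((T ^^ n) x))) \<le> \<eta>/4 * real M"
      using \<gamma>[OF u] l by (intro \<delta> iter_in u x) (auto simp: u_def)
    have 2: "\<forall>\<^sub>F M in sequentially. (\<Sum>i<M. dist ((T ^^ i) u) ((T ^^ i) x)) \<le> \<eta>/4 * real M"
      using l by (intro \<delta> u x) (auto simp: u_def)
    have "\<forall>\<^sub>F M in sequentially. (\<Sum>i<M. dist ((T ^^ i) ((T ^^ n) y)) ((T ^^ i) y)) \<le> \<eta>/4 * real M"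
      by (intro \<delta> iter_in y n)
    \<comment> \<open>The orbit of \<open>u\<close> is that of \<open>y\<close> delayed by
      \<open>l\<close>, so its first \<open>M\<close> terms sit inside a window of length
      \<open>M + l\<close>. For \<open>M \<ge> l\<close> this at most doubles the bound, to
      \<eta>/2.\<close>
    then have 3: "\<forall>\<^sub>F M in sequentially.
        (\<Sum>i<M+l. dist ((T ^^ i) ((T ^^ n) y)) ((T ^^ i) y)) \<le> \<eta>/4 * real (M+l)"
      by (rule sequentially_offset)
    show "\<forall>\<^sub>F M in sequentially. (\<Sum>i<M. dist ((T ^^ i) ((T ^^ n) x)) ((T ^^ i) x)) \<le> \<eta> * real M"
      using 1 2 3 eventually_ge_at_top[of l]
    proof eventually_elim
      case (elim M)
      have shift: "dist ((T ^^ i) ((T ^^ n) u)) ((T ^^ i) u)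
          = dist ((T ^^ (i + l)) ((T ^^ n) y)) ((T ^^ (i + l)) y)" for i
        by (simp add: u_def funpow_funpow ac_simps)
      have "(\<Sum>i<M. dist ((T ^^ i) ((T ^^ n) u)) ((T ^^ i) u))
          = (\<Sum>i\<in>(\<lambda>i. i + l) ` {..<M}. dist ((T ^^ i) ((T ^^ n) y)) ((T ^^ i) y))"
        by (subst sum.reindex) (auto simp: shift)
      also have "\<dots> \<le> (\<Sum>i<M+l. dist ((T ^^ i) ((T ^^ n) y)) ((T ^^ i) y))"
        by (rule sum_mono2) auto
      also have "\<dots> \<le> \<eta>/2 * M"
      proof -
        have "\<eta> * real l \<le> \<eta> * real M"
          using elim(4) assms by (intro mult_left_mono) auto
        then show ?thesis using elim(3) by (simp add: distrib_left)
      qed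
      finally have mid: "(\<Sum>i<M. dist ((T ^^ i) ((T ^^ n) u)) ((T ^^ i) u)) \<le> \<eta>/2 * M" .
      have "(\<Sum>i<M. dist ((T ^^ i) ((T ^^ n) x)) ((T ^^ i) x)) \<le>
          (\<Sum>i<M. dist ((T ^^ i) ((T ^^ n) u)) ((T ^^ i) ((T ^^ n) x))
             + dist ((T ^^ i) ((T ^^ n) u)) ((T ^^ i) u) + dist ((T ^^ i) u) ((T ^^ i) x))"
        by (intro sum_mono) (smt (verit) dist_commute dist_triangle)
      also have "\<dots> \<le> \<eta>/4 * M + \<eta>/2 * M + \<eta>/4 * M"
        using elim(1,2) mid by (simp add: sum.distrib)
      finally show ?case by (simp add: field_simps)
    qed
  qed
  then show ?thesis using \<open>\<delta> > 0\<close> by blast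
qed

text \<open>Pigeonhole: with \<open>X\<close> covered by finitely many balls of radius \<delta>/2,
  some ball receives at least \<open>N / card P\<close> of the first \<open>N\<close> orbit points
  of \<open>x0\<close>. Differences of these visiting times are return times within \<delta>, and
  the constant \<open>1 / card P\<close> is independent of \<open>N\<close>.\<close>

lemma mean_returns_density:
  assumes "0 < \<eta>" "X \<noteq> {}"
  shows "\<exists>c>0. \<forall>N. c * real N \<le> real (card (mean_returns \<eta> \<inter> {..<N}))"
proof -
  obtain \<delta> where "\<delta> > 0" and \<delta>: "\<And>y n. y \<in> X \<Longrightarrow> dist ((T ^^ n) y) y \<le> \<delta> \<Longrightarrow> n \<in> mean_returns \<eta>"
    using mean_returns_from_point[OF assms(1)] by blast
  obtain x0 where x0: "x0 \<in> X" using assms(2) by blast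
  obtain P where P: "finite P" "P \<subseteq> X" "X \<subseteq> (\<Union>p\<in>P. ball p (\<delta>/2))"
    using compactE_image[OF compact_X, of X "\<lambda>p. ball p (\<delta>/2)"] \<open>\<delta> > 0\<close>
    by (metis UN_I centre_in_ball half_gt_zero open_ball subsetI)
  have "\<exists>p\<in>P. dist p ((T ^^ k) x0) < \<delta>/2" for k
    using subsetD[OF P(3) iter_in[OF x0]] by (auto simp: mem_ball simp del: less_divide_eq_numeral1)
  then obtain f where f: "\<And>k. f k \<in> P" "\<And>k. dist (f k) ((T ^^ k) x0) < \<delta>/2"
    by metis
  have P0: "card P > 0" using f(1) P(1) card_gt_0_iff by blast
  have "real N / card P \<le> real (card (mean_returns \<eta> \<inter> {..<N}))" for N
  proof (cases "N = 0")
    case False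
    have "\<exists>p\<in>P. real N / card P \<le> card {k\<in>{..<N}. f k = p}"
    proof (rule ccontr)
      assume "\<not> ?thesis"
      then have "(\<Sum>p\<in>P. real (card {k\<in>{..<N}. f k = p})) < (\<Sum>p\<in>P. real N / card P)"
        using P(1) P0 by (intro sum_strict_mono) auto
      also have "\<dots> = N" using P0 by simp
      finally have "(\<Sum>p\<in>P. card {k\<in>{..<N}. f k = p}) < N"
        unfolding of_nat_sum[symmetric] of_nat_less_iff .
      moreover have "(\<Sum>p\<in>P. card {k\<in>{..<N}. f k = p}) = card {..<N}"
        using sum.group[of "{..<N}" P f "\<lambda>_. 1::nat"] f(1) P(1) by (simp add: image_subset_iff)
      ultimately show False by simp
    qed
    then obtain p where p: "real N / card P \<le> card {k\<in>{..<N}. f k = p}" by blast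
    define F where "F = {k\<in>{..<N}. f k = p}"
    have "finite F" unfolding F_def by simp
    have "F \<noteq> {}"
      using p False P0 unfolding F_def[symmetric] by (auto simp: field_simps)
    \<comment> \<open>Subtracting the first visit \<open>m\<close> keeps the times distinct and
      below \<open>N\<close>. The returning point \<open>T ^^ m\<close> of \<open>x0\<close> changes
      with \<open>N\<close>, which is harmless because \<delta> serves all points of
      \<open>X\<close>.\<close>
    define m where "m = Min F"
    have mF: "m \<in> F" and mle: "\<And>k. k \<in> F \<Longrightarrow> m \<le> k"
      using \<open>finite F\<close> \<open>F \<noteq> {}\<close> by (auto simp: m_def)
    have "(\<lambda>k. k - m) ` F \<subseteq> mean_returns \<eta> \<inter> {..<N}"
    proof safe
      fix k assume k: "k \<in> F"
      then have "dist ((T ^^ (k - m)) ((T ^^ m) x0)) ((T ^^ m) x0) = dist ((T ^^ k) x0) ((T ^^ m) x0)"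
        using mle[OF k] by (simp add: funpow_funpow)
      also have "\<dots> \<le> \<delta>"
        using f(2)[of k] f(2)[of m] k mF dist_triangle3[of "(T ^^ k) x0" "(T ^^ m) x0" p]
        by (auto simp: F_def)
      finally show "k - m \<in> mean_returns \<eta>"
        by (intro \<delta>[OF iter_in[OF x0]])
      show "k - m < N" using k by (auto simp: F_def)
    qed
    moreover have "inj_on (\<lambda>k. k - m) F"
      using mle by (intro inj_onI) (metis le_add_diff_inverse2)
    ultimately have "card F \<le> card (mean_returns \<eta> \<inter> {..<N})"
      by (metis card_image card_mono finite_Int finite_lessThan)
    then show ?thesis using p by (simp add: F_def)
  qed simp
  then show ?thesis
    using P0 by (intro exI[of _ "1 / card P"]) auto
qed

end

subsection \<open>Minimality of the diagonal point\<close>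

lemma forward_orbit_subset:
  assumes "S ` C \<subseteq> C" "y \<in> C"
  shows "forward_orbit S y \<subseteq> C"
  using funpow_in[OF assms] by (auto simp: forward_orbit_def)

text \<open>Orbit closures are closed and forward invariant, so as soon as the orbit closure of
  \<open>z\<close> contains \<open>y\<close> it contains the whole orbit closure of
  \<open>y\<close>.\<close>

lemma minimal_pointI:
  assumes tds: "tds Y S" and y: "y \<in> Y"
    and return: "\<And>z. z \<in> Y \<Longrightarrow> z \<in> closure (forward_orbit S y) \<Longrightarrow> y \<in> closure (forward_orbit S z)"
  shows "minimal_point Y S y"
proof -
  have Y: "compact Y" "continuous_on Y S" "S ` Y \<subseteq> Y" using tds by (auto simp: tds_def)
  have sub: "closure (forward_orbit S z) \<subseteq> Y" if "z \<in> Y" for z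
    using forward_orbit_subset[OF Y(3) that] by (intro closure_minimal compact_imp_closed Y)
  have inv: "S ` closure (forward_orbit S z) \<subseteq> closure (forward_orbit S z)" if "z \<in> Y" for z
  proof (rule image_closure_subset)
    show "continuous_on (closure (forward_orbit S z)) S"
      using Y(2) sub[OF that] by (rule continuous_on_subset)
    have "S ((S ^^ n) z) \<in> forward_orbit S z" for n
      unfolding forward_orbit_def by (rule range_eqI[of _ _ "Suc n"]) simp
    then show "S ` forward_orbit S z \<subseteq> closure (forward_orbit S z)"
      using closure_subset by (fastforce simp: forward_orbit_def)
  qed auto
  let ?C = "Y \<inter> closure (forward_orbit S y)"
  have "tds ?C S"
    unfolding tds_def using Y inv[OF y]
    by (auto intro: compact_Int_closed continuous_on_subset)
  moreover have "?C \<subseteq> closure (forward_orbit S z)" if z: "z \<in> ?C" for z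
  proof -
    have "forward_orbit S y \<subseteq> closure (forward_orbit S z)"
      using z return by (intro forward_orbit_subset inv) auto
    then show ?thesis
      using closure_minimal by blast
  qed
  ultimately show ?thesis using y by (auto simp: minimal_point_def minimal_tds_def)
qed

section \<open>Topology of the power space\<close>

lemma tendsto_fun_iff:
  fixes f :: "'b \<Rightarrow> 'i \<Rightarrow> 'a::topological_space"
  shows "(f \<longlongrightarrow> l) F \<longleftrightarrow> (\<forall>i. ((\<lambda>n. f n i) \<longlongrightarrow> l i) F)"
  using limitin_componentwise[of "\<lambda>_. euclidean" UNIV f l F]
  by (simp add: euclidean_product_topology)

lemma compact_power_space:
  fixes X :: "'a::topological_space set"
  assumes "compact X"
  shows "compact (power_space d X)"
proof -
  \<comment> \<open>Coordinates outside \<open>{1..d}\<close> are confined to the compact singleton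
    \<open>{undefined}\<close>, so Tychonoff's theorem applies over the whole index type.\<close>
  have eq: "power_space d X = PiE UNIV (\<lambda>j. if j \<in> {1..d} then X else {undefined})"
    by (auto simp: power_space_def PiE_iff extensional_def split: if_splits)
  have "compactin (product_topology (\<lambda>_. euclidean) UNIV) (power_space d X)"
    unfolding eq compactin_PiE using assms by auto
  then show ?thesis by (simp add: euclidean_product_topology)
qed

text \<open>Membership in the power space enters at \<open>n = 0\<close>: the restricted function on
  the right is \<open>f\<close> only because \<open>f\<close> is extensional.\<close>

lemma iter_product_powers_map:
  assumes "f \<in> power_space d X"
  shows "(product_powers_map d T ^^ n) f = (\<lambda>j\<in>{1..d}. (T ^^ (j * n)) (f j))"
proof (induction n)
  case 0
  then show ?case using assms by (auto simp: power_space_def fun_eq_iff PiE_iff extensional_def)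
next
  case (Suc n)
  then show ?case by (auto simp: product_powers_map_def funpow_funpow)
qed

section \<open>Dynamics on the power space and multiply recurrent points\<close>

context minimal_mean_equicontinuous
begin

lemma tds_power_space: "tds (power_space d X) (product_powers_map d T)"
proof -
  have "continuous_on (power_space d X) (\<lambda>f. product_powers_map d T f j)" for j
  proof (cases "j \<in> {1..d}")
    case True
    then have "continuous_on (power_space d X) (\<lambda>f. (T ^^ j) (f j))"
      by (intro continuous_on_compose2[OF continuous_iter] continuous_on_subset[OF continuous_on_product_coordinates])
         (auto simp: power_space_def)
    then show ?thesis using True by (simp add: product_powers_map_def)
  next
    case False
    then show ?thesis
      by (subst continuous_on_cong[OF refl, where g="\<lambda>_. undefined"]) (auto simp: product_powers_map_def)
  qed
  then have "continuous_on (power_space d X) (product_powers_map d T)"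
    by (rule continuous_on_coordinatewise_then_product)
  moreover have "product_powers_map d T ` power_space d X \<subseteq> power_space d X"
  proof (rule image_subsetI)
    fix f assume f: "f \<in> power_space d X"
    have "f j \<in> X" if "j \<in> {1..d}" for j
      using f that unfolding power_space_def by (rule PiE_mem)
    then show "product_powers_map d T f \<in> power_space d X"
      by (simp add: power_space_def product_powers_map_def iter_in)
  qed
  ultimately show ?thesis
    by (simp add: tds_def compact_power_space compact_X)
qed

text \<open>Simultaneous returns of positive upper density, hence the frequently quantifier. Since
  the exceptional times are bounded for all large \<open>N\<close>, a single suitable
  \<open>N\<close> can then be extracted.\<close>

definition multiply_recurrent :: "nat \<Rightarrow> 'a \<Rightarrow> bool" where
  "multiply_recurrent d x \<longleftrightarrow> (\<forall>\<epsilon>>0. \<exists>c>0. \<exists>\<^sub>F N in sequentially.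
     c * real N \<le> real (card {n. n < N \<and> (\<forall>j\<in>{1..d}. dist ((T ^^ (j * n)) x) x < \<epsilon>)}))"

text \<open>Markov's inequality for counting: each far time contributes at least \<epsilon> to the
  sum of distances along the orbit. The times \<open>j * n\<close> live in a window of length
  \<open>j * N\<close>, which the divisor \<open>j\<close> in the threshold compensates.\<close>

lemma eventually_card_far_less:
  assumes "0 < \<epsilon>" "0 < c" "0 < j"
  shows "\<exists>\<delta>>0. \<forall>u\<in>X. \<forall>z\<in>X. dist u z < \<delta> \<longrightarrow> (\<forall>\<^sub>F N in sequentially.
    real (card {n. n < N \<and> \<epsilon> \<le> dist ((T ^^ (j * n)) u) ((T ^^ (j * n)) z)}) \<le> c * real N)"
proof -
  have "0 < c * \<epsilon> / j" using assms by simp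
  then obtain \<delta> where "\<delta> > 0" and \<delta>: "\<And>x y. x \<in> X \<Longrightarrow> y \<in> X \<Longrightarrow> dist x y \<le> \<delta> \<Longrightarrow>
      \<forall>\<^sub>F N in sequentially. (\<Sum>i<N. dist ((T ^^ i) x) ((T ^^ i) y)) \<le> c * \<epsilon> / j * real N"
    using eventually_sum_dist_le[OF \<open>0 < c * \<epsilon> / j\<close>] by blast
  have "\<forall>\<^sub>F N in sequentially.
      real (card {n. n < N \<and> \<epsilon> \<le> dist ((T ^^ (j * n)) u) ((T ^^ (j * n)) z)}) \<le> c * real N"
    if "u \<in> X" "z \<in> X" "dist u z < \<delta>" for u z
  proof -
    have "filterlim (\<lambda>N. j * N) sequentially sequentially"
      using assms(3) by (intro filterlim_subseq) (simp add: strict_mono_def)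
    then have "\<forall>\<^sub>F N in sequentially. (\<Sum>i<j*N. dist ((T ^^ i) u) ((T ^^ i) z)) \<le> c * \<epsilon> / j * real (j * N)"
      using \<delta>[of u z] that unfolding filterlim_iff by auto
    then show ?thesis
    proof eventually_elim
      case (elim N)
      let ?F = "{n. n < N \<and> \<epsilon> \<le> dist ((T ^^ (j * n)) u) ((T ^^ (j * n)) z)}"
      have "\<epsilon> * real (card ?F) = (\<Sum>n\<in>?F. \<epsilon>)" by simp
      also have "\<dots> \<le> (\<Sum>n\<in>?F. dist ((T ^^ (j * n)) u) ((T ^^ (j * n)) z))"
        by (rule sum_mono) auto
      also have "\<dots> = (\<Sum>i\<in>(\<lambda>n. j * n) ` ?F. dist ((T ^^ i) u) ((T ^^ i) z))"
        using assms(3) by (subst sum.reindex) (auto simp: inj_on_def)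
      also have "\<dots> \<le> (\<Sum>i<j*N. dist ((T ^^ i) u) ((T ^^ i) z))"
        using assms(3) by (intro sum_mono2) auto
      also have "\<dots> \<le> \<epsilon> * (c * real N)"
        using elim assms(3) by (simp add: field_simps)
      finally show ?case using assms(1) by simp
    qed
  qed
  then show ?thesis using \<open>\<delta> > 0\<close> by blast
qed

text \<open>If \<open>z\<close> is close to \<open>S\<^sup>m y\<close>, the orbits of \<open>z\<close> and \<open>S\<^sup>m y\<close> stay close except on a set of times of
  small density, so the positive-density returns of \<open>y\<close> to itself force \<open>z\<close> to return to \<open>y\<close>.\<close>

lemma minimal_point_of_multiply_recurrent:
  assumes x: "x \<in> X" and rec: "multiply_recurrent d x"
  shows "minimal_point (power_space d X) (product_powers_map d T) (diagonal_point d x)"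
proof (rule minimal_pointI[OF tds_power_space])
  let ?S = "product_powers_map d T" and ?y = "diagonal_point d x"
  show y: "?y \<in> power_space d X"
    using x by (auto simp: diagonal_point_def power_space_def)
  fix z assume z: "z \<in> power_space d X" "z \<in> closure (forward_orbit ?S ?y)"
  have zX: "z j \<in> X" if "j \<in> {1..d}" for j
    using z(1) that by (auto simp: power_space_def)
  have approx: "\<exists>n. \<forall>j\<in>{1..d}. dist ((T ^^ (j * n)) (z j)) x < \<epsilon>" if "\<epsilon> > 0" for \<epsilon>
  proof -
    have "\<epsilon>/2 > 0" using that by simp
    then obtain c where "c > 0" and c: "\<exists>\<^sub>F N in sequentially.
      c * real N \<le> real (card {n. n < N \<and> (\<forall>j\<in>{1..d}. dist ((T ^^ (j * n)) x) x < \<epsilon>/2)})"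
      using rec unfolding multiply_recurrent_def by blast
    \<comment> \<open>The \<open>d\<close> exceptional sets, one per coordinate, together get at
      most half of the density \<open>c\<close>. \<open>Suc d\<close> keeps the denominator positive
      also for \<open>d = 0\<close>.\<close>
    define c' where "c' = c / (2 * real (Suc d))"
    have "c' > 0" using \<open>c > 0\<close> by (simp add: c'_def)
    have "\<forall>j\<in>{1..d}. \<exists>\<delta>>0. \<forall>u\<in>X. \<forall>z\<in>X. dist u z < \<delta> \<longrightarrow> (\<forall>\<^sub>F N in sequentially.
      real (card {n. n < N \<and> \<epsilon>/2 \<le> dist ((T ^^ (j * n)) u) ((T ^^ (j * n)) z)}) \<le> c' * real N)"
      using eventually_card_far_less[OF \<open>\<epsilon>/2 > 0\<close> \<open>c' > 0\<close>] by simp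
    then obtain \<delta> where \<delta>: "\<forall>j\<in>{1..d}. 0 < \<delta> j \<and>
      (\<forall>u\<in>X. \<forall>z\<in>X. dist u z < \<delta> j \<longrightarrow> (\<forall>\<^sub>F N in sequentially.
      real (card {n. n < N \<and> \<epsilon>/2 \<le> dist ((T ^^ (j * n)) u) ((T ^^ (j * n)) z)}) \<le> c' * real N))"
      by (elim bchoice[THEN exE])
    obtain w where w: "\<And>k. w k \<in> forward_orbit ?S ?y" "w \<longlonglongrightarrow> z"
      using z(2) unfolding closure_sequential by blast
    have "\<forall>\<^sub>F k in sequentially. \<forall>j\<in>{1..d}. dist (w k j) (z j) < \<delta> j"
      using w(2) \<delta> unfolding tendsto_fun_iff by (intro eventually_ball_finite ballI tendstoD) auto
    then obtain k where k: "\<forall>j\<in>{1..d}. dist (w k j) (z j) < \<delta> j"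
      using eventually_happens'[OF sequentially_bot] by blast
    obtain m where "w k = (?S ^^ m) ?y" using w(1)[of k] by (auto simp: forward_orbit_def)
    then have m: "dist ((T ^^ (j * m)) x) (z j) < \<delta> j" if "j \<in> {1..d}" for j
    proof -
      have "w k j = (T ^^ (j * m)) x"
        unfolding \<open>w k = _\<close> iter_product_powers_map[OF y] using that by (simp add: diagonal_point_def)
      then show ?thesis using k that by metis
    qed
    let ?G = "\<lambda>N. {n. n < N \<and> (\<forall>j\<in>{1..d}. dist ((T ^^ (j * n)) x) x < \<epsilon>/2)}"
    let ?F = "\<lambda>j N. {n. n < N \<and> \<epsilon>/2 \<le> dist ((T ^^ (j * n)) ((T ^^ (j * m)) x)) ((T ^^ (j * n)) (z j))}"
    have far: "\<forall>\<^sub>F N in sequentially. \<forall>j\<in>{1..d}. real (card (?F j N)) \<le> c' * real N"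
      by (intro eventually_ball_finite ballI \<delta>[rule_format, THEN conjunct2, rule_format] iter_in x zX m) auto
    \<comment> \<open>For \<open>N > M\<close> the \<open>m\<close> initial times number less than
      \<open>c / 2 * N\<close>, the other half of the budget.\<close>
    obtain M :: nat where M: "2 * real m / c < real M" using reals_Archimedean2 by blast
    obtain N where N: "c * real N \<le> real (card (?G N))" "\<forall>j\<in>{1..d}. real (card (?F j N)) \<le> c' * real N" "N > M"
      using frequently_eventually_frequently[OF c eventually_conj[OF far eventually_gt_at_top[of M]]]
      by (auto dest!: frequently_ex)
    \<comment> \<open>Fewer than \<open>c * N\<close> times are lost, either for lying before
      \<open>m\<close> or for having \<open>k - m\<close> exceptional, so some return time
      \<open>k\<close> of \<open>x\<close> survives.\<close>
    have "\<not> ?G N \<subseteq> {..<m} \<union> (\<lambda>n. n + m) ` (\<Union>j\<in>{1..d}. ?F j N)"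
    proof
      assume "?G N \<subseteq> {..<m} \<union> (\<lambda>n. n + m) ` (\<Union>j\<in>{1..d}. ?F j N)"
      then have "card (?G N) \<le> card ({..<m} \<union> (\<lambda>n. n + m) ` (\<Union>j\<in>{1..d}. ?F j N))"
        by (intro card_mono) auto
      also have "\<dots> \<le> card {..<m} + card ((\<lambda>n. n + m) ` (\<Union>j\<in>{1..d}. ?F j N))"
        by (rule card_Un_le)
      also have "card ((\<lambda>n. n + m) ` (\<Union>j\<in>{1..d}. ?F j N)) \<le> card (\<Union>j\<in>{1..d}. ?F j N)"
        by (intro card_image_le) auto
      also have "\<dots> \<le> (\<Sum>j\<in>{1..d}. card (?F j N))"
        by (intro card_UN_le) auto
      finally have "real (card (?G N)) \<le> real m + (\<Sum>j\<in>{1..d}. real (card (?F j N)))"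
        by (simp flip: of_nat_sum of_nat_add)
      also have "(\<Sum>j\<in>{1..d}. real (card (?F j N))) \<le> (\<Sum>j\<in>{1..d}. c' * real N)"
        using N(2) by (intro sum_mono) auto
      also have "\<dots> = real d * c' * N" by simp
      also have "\<dots> \<le> c / 2 * N"
        using \<open>c > 0\<close> by (intro mult_right_mono) (simp_all add: c'_def field_simps)
      also have "real m < c / 2 * N"
      proof -
        have "2 * real m / c < real N" using M N(3) by linarith
        then show ?thesis using \<open>c > 0\<close> by (simp add: field_simps)
      qed
      finally show False using N(1) by (simp add: field_simps)
    qed
    then obtain k where "k \<in> ?G N" "k \<notin> {..<m} \<union> (\<lambda>n. n + m) ` (\<Union>j\<in>{1..d}. ?F j N)"
      by blast
    then have k: "k \<in> ?G N" "k \<ge> m" "k \<notin> (\<lambda>n. n + m) ` (\<Union>j\<in>{1..d}. ?F j N)"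
      by (simp_all only: Un_iff de_Morgan_disj lessThan_iff not_less simp_thms)
    define n where "n = k - m"
    have kn: "k = n + m" using k(2) by (simp add: n_def)
    \<comment> \<open>The point \<open>T ^^ (j * k)\<close> of \<open>x\<close> is reached from
      \<open>T ^^ (j * m)\<close> of \<open>x\<close> in \<open>j * n\<close> steps. It lies within
      \<epsilon>/2 of the orbit of \<open>z j\<close> by shadowing and within \<epsilon>/2 of
      \<open>x\<close> by recurrence.\<close>
    have "dist ((T ^^ (j * n)) (z j)) x < \<epsilon>" if j: "j \<in> {1..d}" for j
    proof -
      have "n \<notin> ?F j N" using k(3) j kn by blast
      moreover have "n < N" using k(1) kn by auto
      ultimately have "dist ((T ^^ (j * k)) x) ((T ^^ (j * n)) (z j)) < \<epsilon>/2"
        by (auto simp: funpow_funpow kn distrib_left)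
      moreover have "dist ((T ^^ (j * k)) x) x < \<epsilon>/2" using k(1) j by blast
      ultimately show ?thesis
        using dist_triangle3[of "(T ^^ (j * n)) (z j)" x "(T ^^ (j * k)) x"] by linarith
    qed
    then show ?thesis by blast
  qed
  then have "\<forall>k. \<exists>n. \<forall>j\<in>{1..d}. dist ((T ^^ (j * n)) (z j)) x < 1 / real (Suc k)" by simp
  then obtain n where n: "\<And>k j. j \<in> {1..d} \<Longrightarrow> dist ((T ^^ (j * n k)) (z j)) x < 1 / real (Suc k)"
    by metis
  have "(\<lambda>k. (?S ^^ n k) z) \<longlonglongrightarrow> ?y"
    unfolding tendsto_fun_iff iter_product_powers_map[OF z(1)] diagonal_point_def
  proof
    fix j
    show "(\<lambda>k. (\<lambda>j\<in>{1..d}. (T ^^ (j * n k)) (z j)) j) \<longlonglongrightarrow> (\<lambda>j\<in>{1..d}. x) j"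
    proof (cases "j \<in> {1..d}")
      case True
      have "(\<lambda>k. dist ((T ^^ (j * n k)) (z j)) x) \<longlonglongrightarrow> 0"
        using n[OF True] by (intro tendsto_sandwich[OF _ _ tendsto_const lim_inverse_n'[THEN LIMSEQ_Suc]])
          (auto intro: less_imp_le always_eventually)
      then show ?thesis using True by (simp add: tendsto_dist_iff[symmetric])
    next
      case False
      then show ?thesis by (simp only: restrict_apply if_False tendsto_const)
    qed
  qed
  then show "?y \<in> closure (forward_orbit ?S z)"
    unfolding closure_sequential forward_orbit_def
    by (intro exI[of _ "\<lambda>k. (?S ^^ n k) z"] conjI allI rangeI)
qed

end

subsection \<open>Multiple recurrence\<close>

locale minimal_mean_equicontinuous_measure = minimal_mean_equicontinuous X T
  for X :: "'a::metric_space set" and T :: "'a \<Rightarrow> 'a" +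
  fixes \<mu> :: "'a measure"
  assumes invariant: "invariant_borel_prob X T \<mu>"

sublocale minimal_mean_equicontinuous_measure \<subseteq> prob_space \<mu>
  using invariant by (simp add: invariant_borel_prob_def)

context minimal_mean_equicontinuous_measure
begin

section \<open>Invariance of the measure under iterates\<close>

lemma sets_mu: "sets \<mu> = sets (restrict_space borel X)"
  using invariant by (simp add: invariant_borel_prob_def)

lemma space_mu: "space \<mu> = X"
  using sets_eq_imp_space_eq[OF sets_mu] by (simp add: space_restrict_space)

lemma X_nonempty: "X \<noteq> {}"
  using not_empty space_mu by simp

lemma continuous_imp_borel_measurable: "continuous_on X f \<Longrightarrow> f \<in> borel_measurable \<mu>"
  using borel_measurable_continuous_on_restrict[of X f] measurable_cong_sets[OF sets_mu refl] by blast

lemma measurable_iter [measurable]: "(T ^^ n) \<in> measurable \<mu> \<mu>"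
proof -
  have "(T ^^ n) \<in> measurable \<mu> (restrict_space borel X)"
    using iter_in by (intro measurable_restrict_space2 continuous_imp_borel_measurable continuous_iter)
      (auto simp: space_mu)
  then show ?thesis
    using measurable_cong_sets[OF refl sets_mu] by blast
qed

lemma distr_iter: "distr \<mu> \<mu> (T ^^ n) = \<mu>"
proof (induction n)
  case (Suc n)
  have T: "T \<in> measurable \<mu> \<mu>" using measurable_iter[of 1] by simp
  have "distr \<mu> \<mu> (T ^^ Suc n) = distr (distr \<mu> \<mu> (T ^^ n)) \<mu> T"
    using T by (simp add: distr_distr)
  then show ?case
    using Suc invariant by (simp add: invariant_borel_prob_def o_def)
qed (simp add: id_def)

lemma measure_vimage_iter:
  assumes "A \<in> sets \<mu>"
  shows "measure \<mu> ((T ^^ n) -` A \<inter> X) = measure \<mu> A"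
  using measure_distr[OF measurable_iter assms, of n] by (simp add: distr_iter space_mu)

lemma vimage_iter_sets: "A \<in> sets \<mu> \<Longrightarrow> (T ^^ n) -` A \<inter> X \<in> sets \<mu>"
  using measurable_sets[OF measurable_iter, of A n] by (simp add: space_mu)

lemma integral_iter:
  fixes f :: "'a \<Rightarrow> real"
  assumes "f \<in> borel_measurable \<mu>"
  shows "(\<integral>x. f ((T ^^ n) x) \<partial>\<mu>) = (\<integral>x. f x \<partial>\<mu>)"
  using integral_distr[OF measurable_iter assms, of n] by (simp add: distr_iter)

section \<open>Mean displacement of the iterates\<close>

lemma displacement_measurable: "(\<lambda>x. dist ((T ^^ n) x) x) \<in> borel_measurable \<mu>"
  by (intro continuous_imp_borel_measurable continuous_intros continuous_iter)

lemma displacement_integrable: "integrable \<mu> (\<lambda>x. dist ((T ^^ n) x) x)"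
proof -
  obtain D where "0 \<le> D" and D: "\<And>x y. x \<in> X \<Longrightarrow> y \<in> X \<Longrightarrow> dist x y \<le> D"
    using dist_bound by blast
  show ?thesis
    by (rule integrable_const_bound[OF _ displacement_measurable, where B=D])
       (use D iter_in in \<open>auto simp: space_mu intro!: AE_I2\<close>)
qed

text \<open>By invariance, averaging the displacement along orbits does not change its integral,
  while the averages are eventually at most \<eta> at every point.\<close>

lemma displacement_le_of_mean_return:
  assumes "n \<in> mean_returns \<eta>" "0 \<le> \<eta>"
  shows "(\<integral>x. dist ((T ^^ n) x) x \<partial>\<mu>) \<le> \<eta>"
proof -
  obtain D where D: "0 \<le> D" "\<And>x y. x \<in> X \<Longrightarrow> y \<in> X \<Longrightarrow> dist x y \<le> D"
    using dist_bound by blast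
  define g where "g x = dist ((T ^^ n) x) x" for x
  have gm: "g \<in> borel_measurable \<mu>"
    using displacement_measurable[of n] by (simp add: g_def[abs_def])
  have gT: "(\<lambda>x. g ((T ^^ i) x)) \<in> borel_measurable \<mu>" for i
    using measurable_compose[OF measurable_iter gm] .
  have gbound: "norm (g ((T ^^ i) x)) \<le> D" if "x \<in> X" for i x
    using that by (auto simp: g_def intro!: D iter_in)
  have gi: "integrable \<mu> (\<lambda>x. g ((T ^^ i) x))" for i
    by (rule integrable_const_bound[OF _ gT, where B=D]) (use gbound in \<open>auto simp: space_mu\<close>)
  define A where "A M x = (\<Sum>i<M. g ((T ^^ i) x)) / real M" for M x
  have Am: "A M \<in> borel_measurable \<mu>" for M
    unfolding A_def[abs_def] using gT by measurable
  have A0: "0 \<le> A M x" for M x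
    by (auto simp: A_def g_def intro!: divide_nonneg_nonneg sum_nonneg)
  have AD: "A M x \<le> D" if "x \<in> X" for M x
  proof (cases "M = 0")
    case False
    have "(\<Sum>i<M. g ((T ^^ i) x)) \<le> (\<Sum>i<M. D)"
      using gbound[OF that] by (intro sum_mono) (smt (verit) real_norm_def)
    then show ?thesis using False by (simp add: A_def field_simps)
  qed (use D in \<open>simp add: A_def\<close>)
  \<comment> \<open>The averages need not converge, but their maximum with \<eta> is eventually
    equal to \<eta> at every point, so dominated convergence applies to it.\<close>
  have "(\<lambda>M. \<integral>x. max (A M x) \<eta> \<partial>\<mu>) \<longlonglongrightarrow> (\<integral>x. \<eta> \<partial>\<mu>)"
  proof (rule integral_dominated_convergence[where w="\<lambda>_. max D \<eta>"])
    show "AE x in \<mu>. (\<lambda>M. max (A M x) \<eta>) \<longlonglongrightarrow> \<eta>"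
    proof (rule AE_I2)
      fix x assume "x \<in> space \<mu>"
      then have "\<forall>\<^sub>F M in sequentially. (\<Sum>i<M. dist ((T ^^ i) ((T ^^ n) x)) ((T ^^ i) x)) \<le> \<eta> * real M"
        using assms(1) by (auto simp: mean_returns_def space_mu)
      then have "\<forall>\<^sub>F M in sequentially. max (A M x) \<eta> = \<eta>"
        using eventually_gt_at_top[of 0]
        by eventually_elim (simp add: A_def g_def funpow_funpow add.commute field_simps)
      then show "(\<lambda>M. max (A M x) \<eta>) \<longlonglongrightarrow> \<eta>"
        by (rule tendsto_eventually)
    qed
    show "AE x in \<mu>. norm (max (A M x) \<eta>) \<le> max D \<eta>" for M
    proof (rule AE_I2)
      fix x assume "x \<in> space \<mu>"
      then show "norm (max (A M x) \<eta>) \<le> max D \<eta>"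
        using A0[of M x] AD[of x M] assms(2) by (simp add: space_mu max_def)
    qed
    show "(\<lambda>x. max (A M x) \<eta>) \<in> borel_measurable \<mu>" for M
      using Am by measurable
  qed auto
  moreover have "\<forall>\<^sub>F M in sequentially. (\<integral>x. g x \<partial>\<mu>) \<le> (\<integral>x. max (A M x) \<eta> \<partial>\<mu>)"
    using eventually_gt_at_top[of 0]
  proof eventually_elim
    case (elim M)
    have Ai: "integrable \<mu> (A M)"
      unfolding A_def[abs_def] using gi by simp
    have "(\<integral>x. A M x \<partial>\<mu>) = (\<Sum>i<M. \<integral>x. g ((T ^^ i) x) \<partial>\<mu>) / M"
      unfolding A_def using gi by simp
    also have "\<dots> = (\<integral>x. g x \<partial>\<mu>)"
      using elim by (simp add: integral_iter[OF gm])
    finally have "(\<integral>x. g x \<partial>\<mu>) = (\<integral>x. A M x \<partial>\<mu>)" by simp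
    also have "\<dots> \<le> (\<integral>x. max (A M x) \<eta> \<partial>\<mu>)"
      using Ai by (intro integral_mono) auto
    finally show ?case .
  qed
  ultimately have "(\<integral>x. g x \<partial>\<mu>) \<le> (\<integral>x. \<eta> \<partial>\<mu>)"
    by (intro tendsto_lowerbound) auto
  then show ?thesis by (simp add: g_def prob_space)
qed

section \<open>Measure escaping from a Borel set\<close>

lemma escape_eq:
  assumes "B \<in> sets \<mu>"
  shows "B - (T ^^ n) -` B = B - ((T ^^ n) -` B \<inter> X)"
  using sets.sets_into_space[OF assms] by (auto simp: space_mu)

lemma escape_sets: "B \<in> sets \<mu> \<Longrightarrow> B - (T ^^ n) -` B \<in> sets \<mu>"
  using vimage_iter_sets[of B n] by (simp add: escape_eq sets.Diff)

text \<open>Small mean displacement makes \<open>T ^^ n\<close> nearly preserve each fixed Borel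
  set. The proof is by induction over the sigma-algebra generated by the open sets; \<eta> depends
  on \<open>B\<close> and \<epsilon> but not on \<open>n\<close>.\<close>

lemma iter_escape_small:
  assumes "B \<in> sets \<mu>" "0 < \<epsilon>"
  shows "\<exists>\<eta>>0. \<forall>n. (\<integral>x. dist ((T ^^ n) x) x \<partial>\<mu>) \<le> \<eta> \<longrightarrow> measure \<mu> (B - (T ^^ n) -` B) \<le> \<epsilon>"
proof -
  \<comment> \<open>Members of \<open>sets \<mu>\<close> are traces on \<open>X\<close> of Borel
    sets, and the induction runs over the ambient set \<open>S\<close>. It generalises over
    \<epsilon> because countable unions use smaller values.\<close>
  have eqs: "sets \<mu> = (\<inter>) X ` sigma_sets UNIV {S. open S}"
    unfolding sets_mu sets_restrict_space borel_def by simp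
  then obtain S where S: "S \<in> sigma_sets UNIV {S. open S}" and BS: "B = X \<inter> S"
    using assms(1) by auto
  show ?thesis
    unfolding BS using S assms(2)
  proof (induction arbitrary: \<epsilon>)
    case (Basic S)
    then have S: "open S" by simp
    show ?case
    \<comment> \<open>By convention \<open>infdist\<close> to the empty set is 0, which would make
      every \<open>E k\<close> below equal to \<open>X\<close>.\<close>
    proof (cases "S = UNIV")
      case True
      then have "X \<inter> S - (T ^^ n) -` (X \<inter> S) = {}" for n using iter_in by auto
      then have "measure \<mu> (X \<inter> S - (T ^^ n) -` (X \<inter> S)) \<le> \<epsilon>" for n
        using less_imp_le[OF \<open>0 < \<epsilon>\<close>] by (simp only: measure_empty)
      then show ?thesis by (intro exI[of _ "1::real"] conjI allI impI zero_less_one)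
    next
      case False
      \<comment> \<open>The boundary layers of \<open>S\<close> shrink to the empty set because
        \<open>S\<close> is open, so a thin enough one has measure below \<epsilon>/2.\<close>
      define E where "E k = {x\<in>X. x \<in> S \<and> infdist x (- S) < 1 / real (Suc k)}" for k
      have Em: "E k \<in> sets \<mu>" for k
      proof -
        have "E k = X \<inter> (S \<inter> {x. infdist x (- S) < 1 / real (Suc k)})" by (auto simp: E_def)
        moreover have "open {x. infdist x (- S) < 1 / real (Suc k)}"
          by (intro open_Collect_less continuous_intros)
        ultimately show ?thesis
          using S unfolding sets_mu sets_restrict_space by auto
      qed
      have "decseq E"
      proof (rule antimonoI, safe)
        fix j k :: nat and x assume "j \<le> k" "x \<in> E k"
        then show "x \<in> E j"
          using frac_le[of 1 1 "real (Suc j)" "real (Suc k)"] by (auto simp: E_def)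
      qed
      have "(\<Inter>k. E k) = {}"
      proof safe
        fix x assume x: "x \<in> (\<Inter>k. E k)"
        then have "x \<in> S" by (auto simp: E_def)
        then have "infdist x (- S) > 0"
          using S False by (intro infdist_pos_not_in_closed) auto
        then obtain k where "1 / real (Suc k) < infdist x (- S)"
          using nat_approx_posE by (metis)
        then show "x \<in> {}" using x by (auto simp: E_def dest!: spec[of _ k])
      qed
      then have "(\<lambda>k. measure \<mu> (E k)) \<longlonglongrightarrow> 0"
        using finite_Lim_measure_decseq[of E] Em \<open>decseq E\<close> by auto
      then obtain k where k: "measure \<mu> (E k) < \<epsilon>/2"
        using \<open>0 < \<epsilon>\<close> order_tendstoD(2)[of _ 0 sequentially "\<epsilon>/2"] eventually_happens'[OF sequentially_bot]
        by fastforce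
      define \<delta> where "\<delta> = 1 / real (Suc k)"
      have "\<delta> > 0" by (simp add: \<delta>_def)
      have "measure \<mu> (X \<inter> S - (T ^^ n) -` (X \<inter> S)) \<le> \<epsilon>"
        if n: "(\<integral>x. dist ((T ^^ n) x) x \<partial>\<mu>) \<le> \<delta> * \<epsilon> / 2" for n
      proof -
        have far: "{x \<in> space \<mu>. dist ((T ^^ n) x) x \<ge> \<delta>} \<in> sets \<mu>"
          using displacement_measurable[of n] by measurable
        \<comment> \<open>Off the layer \<open>E k\<close>, leaving \<open>S\<close> requires a move
          of at least \<delta>; Markov's inequality bounds the measure of such moves.\<close>
        have "X \<inter> S - (T ^^ n) -` (X \<inter> S) \<subseteq> E k \<union> {x \<in> space \<mu>. dist ((T ^^ n) x) x \<ge> \<delta>}"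
        proof
          fix x assume x: "x \<in> X \<inter> S - (T ^^ n) -` (X \<inter> S)"
          then have "(T ^^ n) x \<in> - S" using iter_in by auto
          then have "infdist x (- S) \<le> dist x ((T ^^ n) x)" by (rule infdist_le)
          then show "x \<in> E k \<union> {x \<in> space \<mu>. dist ((T ^^ n) x) x \<ge> \<delta>}"
            using x by (auto simp: E_def space_mu \<delta>_def dist_commute)
        qed
        then have "measure \<mu> (X \<inter> S - (T ^^ n) -` (X \<inter> S))
            \<le> measure \<mu> (E k \<union> {x \<in> space \<mu>. dist ((T ^^ n) x) x \<ge> \<delta>})"
          using Em far by (intro finite_measure_mono) auto
        also have "\<dots> \<le> measure \<mu> (E k) + measure \<mu> {x \<in> space \<mu>. dist ((T ^^ n) x) x \<ge> \<delta>}"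
          using Em far by (intro measure_Un_le) auto
        also have "measure \<mu> {x \<in> space \<mu>. dist ((T ^^ n) x) x \<ge> \<delta>} \<le> (\<integral>x. dist ((T ^^ n) x) x \<partial>\<mu>) / \<delta>"
          using \<open>\<delta> > 0\<close> by (intro integral_Markov_inequality_measure[where A="space \<mu>"] displacement_integrable) auto
        also have "\<dots> \<le> \<epsilon>/2" using n \<open>\<delta> > 0\<close> by (simp add: field_simps)
        finally show ?thesis using k by simp
      qed
      then show ?thesis
        using \<open>\<delta> > 0\<close> \<open>0 < \<epsilon>\<close> by (intro exI[of _ "\<delta> * \<epsilon> / 2"]) auto
    qed
  next
    case Empty
    then show ?case by (auto intro!: exI[of _ 1])
  next
    case (Compl S)
    have SB: "X \<inter> S \<in> sets \<mu>" using eqs Compl.hyps by auto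
    \<comment> \<open>What leaves the complement enters \<open>S\<close>. Since \<open>S\<close> and
      its preimage have the same trace measure by invariance, their two differences have equal
      measure.\<close>
    have "measure \<mu> (X \<inter> (UNIV - S) - (T ^^ n) -` (X \<inter> (UNIV - S)))
        = measure \<mu> (X \<inter> S - (T ^^ n) -` (X \<inter> S))" for n
    proof -
      let ?P = "(T ^^ n) -` (X \<inter> S) \<inter> X"
      have P: "?P \<in> sets \<mu>" using vimage_iter_sets[OF SB] .
      have "X \<inter> (UNIV - S) - (T ^^ n) -` (X \<inter> (UNIV - S)) = ?P - X \<inter> S"
        using iter_in by auto
      moreover have "measure \<mu> (?P - X \<inter> S) = measure \<mu> ?P - measure \<mu> (?P \<inter> (X \<inter> S))"
        using P SB by (simp add: finite_measure_Diff')
      moreover have "measure \<mu> (X \<inter> S - ?P) = measure \<mu> (X \<inter> S) - measure \<mu> (?P \<inter> (X \<inter> S))"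
        using P SB by (simp add: finite_measure_Diff' Int_commute)
      ultimately show ?thesis
        using measure_vimage_iter[OF SB, of n] escape_eq[OF SB, of n] by simp
    qed
    then show ?case using Compl.IH[OF Compl.prems] by simp
  next
    case (Union S)
    have SB: "X \<inter> S i \<in> sets \<mu>" for i using eqs Union.hyps by auto
    \<comment> \<open>Finitely many pieces exhaust the union up to measure \<epsilon>/2; the other
      \<epsilon>/2 is shared among the escapes from these pieces.\<close>
    define U where "U K = (\<Union>i<K. X \<inter> S i)" for K :: nat
    have US: "U K \<in> sets \<mu>" for K unfolding U_def using SB by (intro sets.finite_UN) auto
    have V: "X \<inter> (\<Union>i. S i) \<in> sets \<mu>" 
      using SB by (metis (no_types, lifting) Int_UN_distrib sets.countable_UN image_subsetI)
    have "(\<lambda>K. measure \<mu> (X \<inter> (\<Union>i. S i) - U K)) \<longlonglongrightarrow> measure \<mu> (\<Inter>K. X \<inter> (\<Union>i. S i) - U K)"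
    proof (rule finite_Lim_measure_decseq)
      have "U K \<subseteq> U L" if "K \<le> L" for K L
        unfolding U_def using that by (intro UN_mono) auto
      then show "decseq (\<lambda>K. X \<inter> (\<Union>i. S i) - U K)"
        unfolding decseq_def by blast
    qed (use US V in blast)
    moreover have "(\<Inter>K. X \<inter> (\<Union>i. S i) - U K) = {}"
      by (auto simp: U_def)
    ultimately have "(\<lambda>K. measure \<mu> (X \<inter> (\<Union>i. S i) - U K)) \<longlonglongrightarrow> 0" by (simp only: measure_empty)
    then obtain K where K: "measure \<mu> (X \<inter> (\<Union>i. S i) - U K) < \<epsilon>/2"
      using \<open>0 < \<epsilon>\<close> order_tendstoD(2)[of _ 0 sequentially "\<epsilon>/2"] eventually_happens'[OF sequentially_bot]
      by fastforce
    have "\<forall>i. \<exists>\<eta>>0. \<forall>n. (\<integral>x. dist ((T ^^ n) x) x \<partial>\<mu>) \<le> \<eta> \<longrightarrow>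
        measure \<mu> (X \<inter> S i - (T ^^ n) -` (X \<inter> S i)) \<le> \<epsilon> / (2 * real (Suc K))"
      using Union.IH \<open>0 < \<epsilon>\<close> by simp
    then obtain \<eta> where \<eta>: "\<And>i. \<eta> i > 0" "\<And>i n. (\<integral>x. dist ((T ^^ n) x) x \<partial>\<mu>) \<le> \<eta> i \<Longrightarrow>
        measure \<mu> (X \<inter> S i - (T ^^ n) -` (X \<inter> S i)) \<le> \<epsilon> / (2 * real (Suc K))"
      by metis
    \<comment> \<open>The range \<open>{..K}\<close> instead of \<open>{..<K}\<close> keeps the
      minimum over a nonempty set when \<open>K = 0\<close>.\<close>
    define \<theta> where "\<theta> = Min (\<eta> ` {..K})"
    have \<theta>: "\<theta> > 0" "\<And>i. i < K \<Longrightarrow> \<theta> \<le> \<eta> i" using \<eta>(1) by (auto simp: \<theta>_def)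
    have "measure \<mu> (X \<inter> (\<Union>i. S i) - (T ^^ n) -` (X \<inter> (\<Union>i. S i))) \<le> \<epsilon>"
      if n: "(\<integral>x. dist ((T ^^ n) x) x \<partial>\<mu>) \<le> \<theta>" for n
    proof -
      let ?W = "\<lambda>i. X \<inter> S i - (T ^^ n) -` (X \<inter> S i)"
      have W: "?W i \<in> sets \<mu>" for i using escape_sets[OF SB] .
      have "X \<inter> (\<Union>i. S i) - (T ^^ n) -` (X \<inter> (\<Union>i. S i)) \<subseteq> (X \<inter> (\<Union>i. S i) - U K) \<union> (\<Union>i<K. ?W i)"
        by (auto simp: U_def)
      then have "measure \<mu> (X \<inter> (\<Union>i. S i) - (T ^^ n) -` (X \<inter> (\<Union>i. S i)))
          \<le> measure \<mu> ((X \<inter> (\<Union>i. S i) - U K) \<union> (\<Union>i<K. ?W i))"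
        using V US W by (intro finite_measure_mono) auto
      also have "\<dots> \<le> measure \<mu> (X \<inter> (\<Union>i. S i) - U K) + measure \<mu> (\<Union>i<K. ?W i)"
        using V US W by (intro measure_Un_le) auto
      also have "measure \<mu> (\<Union>i<K. ?W i) \<le> (\<Sum>i<K. measure \<mu> (?W i))"
        using W by (intro measure_UNION_le) auto
      also have "\<dots> \<le> (\<Sum>i<K. \<epsilon> / (2 * real (Suc K)))"
        using order_trans[OF n \<theta>(2)] by (intro sum_mono \<eta>(2)) auto
      also have "\<dots> \<le> \<epsilon>/2" using \<open>0 < \<epsilon>\<close> by (simp add: field_simps)
      finally show ?thesis using K by simp
    qed
    then show ?case using \<theta>(1) by blast
  qed
qed

text \<open>A point of \<open>B\<close> that is outside \<open>B\<close> at time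
  \<open>Suc j * n\<close> is either outside at time \<open>n\<close>, or in \<open>B\<close> then
  and outside \<open>j * n\<close> steps later. By invariance the latter costs no more than an
  escape after \<open>j * n\<close> steps from the start.\<close>

lemma escape_mult:
  assumes B: "B \<in> sets \<mu>"
  shows "measure \<mu> (B - (T ^^ (j * n)) -` B) \<le> real j * measure \<mu> (B - (T ^^ n) -` B)"
proof (induction j)
  case (Suc j)
  let ?E = "\<lambda>m. B - (T ^^ m) -` B"
  have BX: "B \<subseteq> X" using sets.sets_into_space[OF B] by (simp add: space_mu)
  have V: "(T ^^ n) -` ?E (j * n) \<inter> X \<in> sets \<mu>"
    by (intro vimage_iter_sets escape_sets B)
  have "?E (Suc j * n) \<subseteq> ?E n \<union> ((T ^^ n) -` ?E (j * n) \<inter> X)"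
    using BX by (auto simp: funpow_funpow add.commute)
  then have "measure \<mu> (?E (Suc j * n)) \<le> measure \<mu> (?E n \<union> ((T ^^ n) -` ?E (j * n) \<inter> X))"
    using V escape_sets[OF B, of n] by (intro finite_measure_mono) auto
  also have "\<dots> \<le> measure \<mu> (?E n) + measure \<mu> ((T ^^ n) -` ?E (j * n) \<inter> X)"
    using V escape_sets[OF B, of n] by (intro measure_Un_le)
  also have "\<dots> \<le> measure \<mu> (?E n) + real j * measure \<mu> (?E n)"
    using Suc measure_vimage_iter[OF escape_sets[OF B]] by simp
  finally show ?case by (simp add: algebra_simps)
qed simp

section \<open>Multiple recurrence of sets and of points\<close>

definition recurrence_set :: "nat \<Rightarrow> 'a set \<Rightarrow> nat \<Rightarrow> 'a set" where
  "recurrence_set d A n = {x\<in>A. \<forall>j\<in>{1..d}. (T ^^ (j * n)) x \<in> A}"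

lemma recurrence_set_eq: "recurrence_set d A n = A - (\<Union>j\<in>{1..d}. A - (T ^^ (j * n)) -` A)"
  by (auto simp: recurrence_set_def)

lemma recurrence_set_sets: "A \<in> sets \<mu> \<Longrightarrow> recurrence_set d A n \<in> sets \<mu>"
  unfolding recurrence_set_eq by (intro sets.Diff sets.finite_UN escape_sets) auto

text \<open>Multiple recurrence in the rigid form available here: a single \<open>n\<close> for which \<open>T\<^sup>n\<close> moves
  points little on average also makes all \<open>T\<^bsup>jn\<^esup>\<close>, \<open>j \<le> d\<close>, nearly fix \<open>B\<close>.\<close>

lemma multiple_recurrence:
  assumes B: "B \<in> sets \<mu>" and pos: "measure \<mu> B > 0"
  shows "\<exists>c>0. \<forall>N. c * real N \<le> (\<Sum>n<N. measure \<mu> (recurrence_set d B n))"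
proof -
  \<comment> \<open>Each of the \<open>d\<close> escapes costs at most \<open>Suc d\<close> times
    \<epsilon>, so all of them together remove at most half of \<open>B\<close>.\<close>
  define \<epsilon> where "\<epsilon> = measure \<mu> B / (2 * real (Suc d) * real (Suc d))"
  have "\<epsilon> > 0" using pos by (simp add: \<epsilon>_def)
  then obtain \<eta> where "\<eta> > 0" and \<eta>: "\<And>n. (\<integral>x. dist ((T ^^ n) x) x \<partial>\<mu>) \<le> \<eta> \<Longrightarrow>
      measure \<mu> (B - (T ^^ n) -` B) \<le> \<epsilon>"
    using iter_escape_small[OF B] by blast
  obtain c where "c > 0" and c: "\<And>N. c * real N \<le> real (card (mean_returns \<eta> \<inter> {..<N}))"
    using mean_returns_density[OF \<open>\<eta> > 0\<close> X_nonempty] by blast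
  have large: "measure \<mu> B / 2 \<le> measure \<mu> (recurrence_set d B n)" if "n \<in> mean_returns \<eta>" for n
  proof -
    have n: "measure \<mu> (B - (T ^^ n) -` B) \<le> \<epsilon>"
      using displacement_le_of_mean_return[OF that] \<open>\<eta> > 0\<close> by (intro \<eta>) simp
    let ?E = "\<lambda>j. B - (T ^^ (j * n)) -` B"
    have E: "?E j \<in> sets \<mu>" for j by (rule escape_sets[OF B])
    have "measure \<mu> (\<Union>j\<in>{1..d}. ?E j) \<le> (\<Sum>j\<in>{1..d}. measure \<mu> (?E j))"
      using E by (intro measure_UNION_le) auto
    also have "\<dots> \<le> (\<Sum>j\<in>{1..d}. real (Suc d) * \<epsilon>)"
    proof (rule sum_mono)
      fix j assume "j \<in> {1..d}"
      have "measure \<mu> (?E j) \<le> real j * measure \<mu> (B - (T ^^ n) -` B)" by (rule escape_mult[OF B])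
      also have "\<dots> \<le> real (Suc d) * \<epsilon>"
        using \<open>j \<in> {1..d}\<close> n by (intro mult_mono) auto
      finally show "measure \<mu> (?E j) \<le> real (Suc d) * \<epsilon>" .
    qed
    also have "\<dots> = real d * (real (Suc d) * \<epsilon>)" by simp
    also have "\<dots> \<le> real (Suc d) * (real (Suc d) * \<epsilon>)"
      using \<open>\<epsilon> > 0\<close> by (intro mult_right_mono) auto
    also have "\<dots> = measure \<mu> B / 2"
      by (simp add: \<epsilon>_def divide_simps del: of_nat_Suc)
    finally have "measure \<mu> (\<Union>j\<in>{1..d}. ?E j) \<le> measure \<mu> B / 2" .
    moreover have "measure \<mu> (recurrence_set d B n) = measure \<mu> B - measure \<mu> (\<Union>j\<in>{1..d}. ?E j)"
      unfolding recurrence_set_eq using B E by (intro finite_measure_Diff sets.finite_UN) auto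
    ultimately show ?thesis by simp
  qed
  have "c * (measure \<mu> B / 2) * real N \<le> (\<Sum>n<N. measure \<mu> (recurrence_set d B n))" for N
  proof -
    have "c * (measure \<mu> B / 2) * real N \<le> card (mean_returns \<eta> \<inter> {..<N}) * (measure \<mu> B / 2)"
      using mult_right_mono[OF c[of N], of "measure \<mu> B / 2"] by (simp add: mult.commute mult.left_commute)
    also have "\<dots> = (\<Sum>n\<in>mean_returns \<eta> \<inter> {..<N}. measure \<mu> B / 2)" by simp
    also have "\<dots> \<le> (\<Sum>n\<in>mean_returns \<eta> \<inter> {..<N}. measure \<mu> (recurrence_set d B n))"
      using large by (intro sum_mono) auto
    also have "\<dots> \<le> (\<Sum>n<N. measure \<mu> (recurrence_set d B n))"
      by (intro sum_mono2) auto
    finally show ?thesis .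
  qed
  then show ?thesis
    using \<open>c > 0\<close> pos by (intro exI[of _ "c * (measure \<mu> B / 2)"]) auto
qed

text \<open>The exceptional set \<open>Z\<close>, where the return frequencies \<open>f N\<close>
  tend to 0, is fed into \<open>multiple_recurrence\<close> itself. Returns to \<open>Z\<close> are
  returns to \<open>A\<close>, so if \<open>Z\<close> had positive measure the integrals of
  \<open>f N\<close> over \<open>Z\<close> would stay above a positive constant, against dominated
  convergence.\<close>

lemma almost_every_point_recurs:
  assumes A: "A \<in> sets \<mu>"
  shows "\<exists>Z\<in>null_sets \<mu>. \<forall>x\<in>A - Z. \<exists>c>0. \<exists>\<^sub>F N in sequentially.
    c * real N \<le> real (card {n. n < N \<and> (\<forall>j\<in>{1..d}. (T ^^ (j * n)) x \<in> A)})"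
proof -
  define f where "f N x = (\<Sum>n<N. indicator (recurrence_set d A n) x) / real N" for N and x :: 'a
  have fm: "f N \<in> borel_measurable \<mu>" for N
    unfolding f_def[abs_def] using recurrence_set_sets[OF A] by measurable
  have f0: "0 \<le> f N x" for N x
    by (simp add: f_def sum_nonneg)
  have f1: "f N x \<le> 1" for N x
  proof -
    have "(\<Sum>n<N. indicator (recurrence_set d A n) x) \<le> (\<Sum>n<N. 1::real)"
      by (intro sum_mono) (simp add: indicator_def)
    then show ?thesis by (cases "N = 0") (simp_all add: f_def)
  qed
  \<comment> \<open>Convergence of the nonnegative \<open>f N x\<close> to 0 is spelled with
    countably many thresholds, which makes \<open>Z\<close> measurable. Its failure supplies one
    fixed threshold reached for infinitely many \<open>N\<close>.\<close>
  define Z where "Z = {x\<in>space \<mu>. x \<in> A \<and> (\<forall>k::nat. \<exists>N0. \<forall>N\<ge>N0. f N x < 1 / real (Suc k))}"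
  have Zm: "Z \<in> sets \<mu>"
    unfolding Z_def using A fm by measurable
  have "measure \<mu> Z = 0"
  proof (rule ccontr)
    assume "measure \<mu> Z \<noteq> 0"
    then have "measure \<mu> Z > 0" by (simp add: zero_less_measure_iff)
    then obtain c where "c > 0" and c: "\<And>N. c * real N \<le> (\<Sum>n<N. measure \<mu> (recurrence_set d Z n))"
      using multiple_recurrence[OF Zm] by blast
    have "(\<lambda>N. \<integral>x. indicator Z x * f N x \<partial>\<mu>) \<longlonglongrightarrow> (\<integral>x. 0 \<partial>\<mu>)"
    proof (rule integral_dominated_convergence[where w="\<lambda>_. 1"])
      show "AE x in \<mu>. (\<lambda>N. indicator Z x * f N x) \<longlonglongrightarrow> 0"
      proof (rule AE_I2)
        fix x
        show "(\<lambda>N. indicator Z x * f N x) \<longlonglongrightarrow> 0"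
        proof (cases "x \<in> Z")
          case True
          have "\<exists>N0. \<forall>N\<ge>N0. norm (f N x - 0) < r" if "r > 0" for r
          proof -
            obtain k where "1 / real (Suc k) < r" using nat_approx_posE[OF \<open>r > 0\<close>] by metis
            moreover obtain N0 where "\<forall>N\<ge>N0. f N x < 1 / real (Suc k)"
              using True by (auto simp: Z_def)
            ultimately show ?thesis using f0 by (intro exI[of _ N0]) (auto intro: less_trans)
          qed
          then have "(\<lambda>N. f N x) \<longlonglongrightarrow> 0" by (rule LIMSEQ_I)
          then show ?thesis using True by simp
        qed simp
      qed
      show "AE x in \<mu>. norm (indicator Z x * f N x) \<le> 1" for N
        using f0 f1 by (intro AE_I2) (auto simp: indicator_def)
      show "(\<lambda>x. indicator Z x * f N x) \<in> borel_measurable \<mu>" for N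
        using fm Zm by measurable
    qed auto
    moreover have "\<forall>\<^sub>F N in sequentially. c \<le> (\<integral>x. indicator Z x * f N x \<partial>\<mu>)"
      using eventually_gt_at_top[of 0]
    proof eventually_elim
      case (elim N)
      have "indicator Z x * f N x = (\<Sum>n<N. indicator (Z \<inter> recurrence_set d A n) x) / real N" for x
        by (simp add: f_def sum_distrib_left indicator_inter_arith)
      then have E: "(\<integral>x. indicator Z x * f N x \<partial>\<mu>) = (\<Sum>n<N. measure \<mu> (Z \<inter> recurrence_set d A n)) / real N"
        using Zm recurrence_set_sets[OF A] sets.sets_into_space[OF Zm]
        by (simp add: Int_absorb2 emeasure_eq_measure le_infI1)
      have "(\<Sum>n<N. measure \<mu> (recurrence_set d Z n)) \<le> (\<Sum>n<N. measure \<mu> (Z \<inter> recurrence_set d A n))"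
      proof (rule sum_mono)
        fix n
        have "recurrence_set d Z n \<subseteq> Z \<inter> recurrence_set d A n"
          by (auto simp: recurrence_set_def Z_def)
        then show "measure \<mu> (recurrence_set d Z n) \<le> measure \<mu> (Z \<inter> recurrence_set d A n)"
          using Zm recurrence_set_sets[OF A] by (intro finite_measure_mono) auto
      qed
      then have "c * real N \<le> (\<Sum>n<N. measure \<mu> (Z \<inter> recurrence_set d A n))"
        using c[of N] by (rule order_trans[rotated])
      then show ?case
        unfolding E using elim by (simp add: pos_le_divide_eq)
    qed
    ultimately have "c \<le> (\<integral>x. 0 \<partial>\<mu>)" by (intro tendsto_lowerbound) auto
    then show False using \<open>c > 0\<close> by simp
  qed
  then have "Z \<in> null_sets \<mu>" using Zm by (simp add: null_sets_def emeasure_eq_measure)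
  moreover have "\<exists>c>0. \<exists>\<^sub>F N in sequentially.
      c * real N \<le> real (card {n. n < N \<and> (\<forall>j\<in>{1..d}. (T ^^ (j * n)) x \<in> A)})" if x: "x \<in> A - Z" for x
  proof -
    have "x \<in> space \<mu>" using x sets.sets_into_space[OF A] by auto
    then obtain k :: nat where k: "\<And>N0. \<exists>N\<ge>N0. 1 / real (Suc k) \<le> f N x"
      using x by (auto simp: Z_def not_less)
    have "f N x = real (card {n. n < N \<and> (\<forall>j\<in>{1..d}. (T ^^ (j * n)) x \<in> A)}) / real N" for N
    proof -
      have "(\<Sum>n<N. indicator (recurrence_set d A n) x) = (\<Sum>n\<in>{n. n < N \<and> (\<forall>j\<in>{1..d}. (T ^^ (j * n)) x \<in> A)}. 1::real)"
        using x by (intro sum.mono_neutral_cong_right) (auto simp: recurrence_set_def indicator_def)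
      then show ?thesis by (simp add: f_def)
    qed
    then have "1 / real (Suc k) * real N \<le> real (card {n. n < N \<and> (\<forall>j\<in>{1..d}. (T ^^ (j * n)) x \<in> A)})"
      if "1 / real (Suc k) \<le> f N x" for N
      using that by (cases "N = 0") (auto simp: field_simps)
    then have "\<exists>\<^sub>F N in sequentially.
        1 / real (Suc k) * real N \<le> real (card {n. n < N \<and> (\<forall>j\<in>{1..d}. (T ^^ (j * n)) x \<in> A)})"
      using k unfolding frequently_sequentially by blast
    then show ?thesis by (intro exI[of _ "1 / real (Suc k)"]) auto
  qed
  ultimately show ?thesis by blast
qed

text \<open>Finite covers by balls of radius \<open>1 / real (Suc k)\<close> reduce recurrence at
  every scale to \<open>almost_every_point_recurs\<close> for countably many sets. A point that
  returns to a ball containing it comes back within twice the radius, and one null set serves all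
  \<open>d\<close>.\<close>

lemma multiply_recurrent_full_measure:
  "\<exists>X\<^sub>0. X\<^sub>0 \<in> sets borel \<and> X\<^sub>0 \<subseteq> X \<and> measure \<mu> X\<^sub>0 = 1 \<and> (\<forall>d. \<forall>x\<in>X\<^sub>0. multiply_recurrent d x)"
proof -
  have "\<exists>P. finite P \<and> P \<subseteq> X \<and> X \<subseteq> (\<Union>p\<in>P. ball p (1 / real (Suc k)))" for k
    using compactE_image[OF compact_X, of X "\<lambda>p. ball p (1 / real (Suc k))"]
    by (metis UN_I centre_in_ball of_nat_0_less_iff open_ball subsetI zero_less_Suc zero_less_divide_1_iff)
  then obtain P where P: "\<And>k. finite (P k)" "\<And>k. X \<subseteq> (\<Union>p\<in>P k. ball p (1 / real (Suc k)))"
    by metis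
  define A where "A k p = X \<inter> ball p (1 / real (Suc k))" for k p
  have A: "A k p \<in> sets \<mu>" for k p
    unfolding A_def sets_mu sets_restrict_space by auto
  define R where "R k d p x \<longleftrightarrow> (\<exists>c>0. \<exists>\<^sub>F N in sequentially.
      c * real N \<le> real (card {n. n < N \<and> (\<forall>j\<in>{1..d}. (T ^^ (j * n)) x \<in> A k p)}))" for k d p x
  have "\<exists>Z. Z \<in> null_sets \<mu> \<and> (\<forall>x\<in>A k p - Z. R k d p x)" for k d p
    using almost_every_point_recurs[OF A, of k p d] unfolding R_def by blast
  then have "\<exists>Z. \<forall>k d p. Z k d p \<in> null_sets \<mu> \<and> (\<forall>x\<in>A k p - Z k d p. R k d p x)"
    by (intro choice allI)
  then obtain Z where Z: "\<And>k d p. Z k d p \<in> null_sets \<mu>"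
    "\<And>k d p x. x \<in> A k p - Z k d p \<Longrightarrow> R k d p x"
    by blast
  \<comment> \<open>Only centres in the finite sets \<open>P k\<close> enter, so the union is
    countable.\<close>
  define W where "W = (\<Union>k. \<Union>d. \<Union>p\<in>P k. Z k d p)"
  have W: "W \<in> null_sets \<mu>"
    unfolding W_def using Z(1) P(1) by (intro null_sets_UN null_sets_UN' countable_finite) auto
  have "multiply_recurrent d x" if x: "x \<in> X - W" for d x
    unfolding multiply_recurrent_def
  proof (intro allI impI)
    fix \<epsilon> :: real assume "\<epsilon> > 0"
    then obtain k where k: "1 / real (Suc k) < \<epsilon> / 2" by (metis half_gt_zero nat_approx_posE)
    obtain p where p: "p \<in> P k" "x \<in> A k p" using P(2)[of k] x by (auto simp: A_def)
    then have "x \<in> A k p - Z k d p" using x by (auto simp: W_def)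
    then obtain c where "c > 0" and c: "\<exists>\<^sub>F N in sequentially.
      c * real N \<le> real (card {n. n < N \<and> (\<forall>j\<in>{1..d}. (T ^^ (j * n)) x \<in> A k p)})"
      using Z(2)[of x k p d] unfolding R_def by blast
    have near: "dist y x < \<epsilon>" if "y \<in> A k p" for y
      using that p(2) k dist_triangle3[of y x p] by (auto simp: A_def)
    have "card {n. n < N \<and> (\<forall>j\<in>{1..d}. (T ^^ (j * n)) x \<in> A k p)}
        \<le> card {n. n < N \<and> (\<forall>j\<in>{1..d}. dist ((T ^^ (j * n)) x) x < \<epsilon>)}" for N
      using near by (intro card_mono) auto
    then have "\<exists>\<^sub>F N in sequentially.
      c * real N \<le> real (card {n. n < N \<and> (\<forall>j\<in>{1..d}. dist ((T ^^ (j * n)) x) x < \<epsilon>)})"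
      by (intro frequently_elim1[OF c]) (meson of_nat_mono order_trans)
    then show "\<exists>c>0. \<exists>\<^sub>F N in sequentially.
      c * real N \<le> real (card {n. n < N \<and> (\<forall>j\<in>{1..d}. dist ((T ^^ (j * n)) x) x < \<epsilon>)})"
      using \<open>c > 0\<close> by blast
  qed
  \<comment> \<open>Since \<open>X\<close> is closed, a Borel subset of the subspace is Borel in the
    ambient space.\<close>
  moreover have "X - W \<in> sets borel"
  proof -
    have "X - W \<in> sets \<mu>" using W sets.top[of \<mu>] by (auto simp: space_mu)
    then obtain S where "S \<in> sets borel" "X - W = X \<inter> S"
      unfolding sets_mu sets_restrict_space by auto
    then show ?thesis
      using compact_imp_closed[OF compact_X] by auto
  qed
  moreover have "measure \<mu> (X - W) = 1"
    using W by (simp add: prob_space space_mu[symmetric] measure_Diff_null_set)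
  ultimately show ?thesis by blast
qed

end

theorem theorem6p1:
  fixes X :: "'a::metric_space set" and T :: "'a \<Rightarrow> 'a" and \<mu> :: "'a measure"
  assumes "minimal_tds X T"
    and "mean_equicontinuous X T"
    and "invariant_borel_prob X T \<mu>"
  shows "\<exists>X\<^sub>0. X\<^sub>0 \<in> sets borel \<and> X\<^sub>0 \<subseteq> X \<and> measure \<mu> X\<^sub>0 = 1 \<and>
           (\<forall>d\<ge>1. \<forall>x\<in>X\<^sub>0. minimal_point (power_space d X) (product_powers_map d T) (diagonal_point d x))"
proof -
  interpret minimal_mean_equicontinuous_measure X T \<mu>
    using assms by unfold_locales
  obtain X\<^sub>0 where "X\<^sub>0 \<in> sets borel" "X\<^sub>0 \<subseteq> X" "measure \<mu> X\<^sub>0 = 1"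
    and "\<And>d x. x \<in> X\<^sub>0 \<Longrightarrow> multiply_recurrent d x"
    using multiply_recurrent_full_measure by blast
  then show ?thesis
    using minimal_point_of_multiply_recurrent by (intro exI[of _ X\<^sub>0]) blast
qed

end
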